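(* Let $G=(V,E)$ be a finite simple graph. Then for every $z\in\mathbb{R}_+^E$, $$\mathrm{GW}^\circ(G,z)\;\le\;\mathrm{fcc}(G,z)\;\le\;\frac{1}{\alpha_{GW}}\,\mathrm{GW}^\circ(G,z).$$
   Context: For $S\subseteq V$, $\delta(S)\subseteq E$ is the set of edges with exactly one endpoint in $S$, and $\chi^{\delta(S)}\in\{0,1\}^E$ is its incidence vector; $\mathbf 1$ is the all-ones vector and $\mathcal P(V)$ the power set of $V$. The fractional cut-covering number of $(G,z)$ is $\mathrm{fcc}(G,z):=\min\{\mathbf 1^{T}y : y\in\mathbb{R}_+^{\mathcal P(V)},\ \sum_{S\subseteq V}y_S\chi^{\delta(S)}\ge z\}$. $\mathbb{S}^V_+$ is the cone of positive semidefinite symmetric $V\times V$ matrices. Define $(\mathcal L_G^*(Y))_{ij}:=Y_{ii}+Y_{jj}-Y_{ij}-Y_{ji}$ for $ij\in E$ (the adjoint of the Laplacian map $\mathcal L_G(w)=\sum_{ij\in E}w_{ij}(e_i-e_j)(e_i-e_j)^T$), and $$\mathrm{GW}^\circ(G,z):=\min\{\mu : \mu\in\mathbb{R}_+,\ Y\in\mathbb{S}^V_+,\ \mathrm{diag}(Y)=\mu\mathbf 1,\ \tfrac14\mathcal L_G^*(Y)\ge z\}.$$ The constant is $\alpha_{GW}:=\min_{0<\vartheta\le\pi}\frac{2}{\pi}\frac{\vartheta}{1-\cos\vartheta}\approx0.878$. *)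

theory Defs
  imports "HOL-Analysis.Analysis"
begin

definition finite_simple_graph :: "'a set \<Rightarrow> 'a set set \<Rightarrow> bool" where
  "finite_simple_graph V E \<longleftrightarrow> finite V \<and> (\<forall>e\<in>E. e \<subseteq> V \<and> card e = 2)"

definition edge_cut :: "'a set set \<Rightarrow> 'a set \<Rightarrow> 'a set set" where
  "edge_cut E S = {e \<in> E. card (e \<inter> S) = 1}"

definition fractional_cut_cover ::
  "'a set \<Rightarrow> 'a set set \<Rightarrow> ('a set \<Rightarrow> real) \<Rightarrow> ('a set \<Rightarrow> real) \<Rightarrow> bool" where
  "fractional_cut_cover V E z y \<longleftrightarrow>
     (\<forall>S\<in>Pow V. 0 \<le> y S) \<and>
     (\<forall>e\<in>E. (\<Sum>S\<in>Pow V. y S * indicator (edge_cut E S) e) \<ge> z e)"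

(* The minima below are taken over infinite sets of reals, to which Min does not apply.
   LEAST denotes the attained minimum, whereas Inf would only give the infimum. *)

definition fcc :: "'a set \<Rightarrow> 'a set set \<Rightarrow> ('a set \<Rightarrow> real) \<Rightarrow> real" where
  "fcc V E z = (LEAST c. \<exists>y. fractional_cut_cover V E z y \<and> c = (\<Sum>S\<in>Pow V. y S))"

(* A V-by-V matrix is a function of two indices; its values off V are never inspected. *)

definition psd_on :: "'a set \<Rightarrow> ('a \<Rightarrow> 'a \<Rightarrow> real) \<Rightarrow> bool" where
  "psd_on V Y \<longleftrightarrow>
     (\<forall>i\<in>V. \<forall>j\<in>V. Y i j = Y j i) \<and>
     (\<forall>x :: 'a \<Rightarrow> real. 0 \<le> (\<Sum>i\<in>V. \<Sum>j\<in>V. x i * Y i j * x j))"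

definition laplacian_adjoint :: "('a \<Rightarrow> 'a \<Rightarrow> real) \<Rightarrow> 'a \<Rightarrow> 'a \<Rightarrow> real" where
  "laplacian_adjoint Y i j = Y i i + Y j j - Y i j - Y j i"

definition GW_polar_feasible ::
  "'a set \<Rightarrow> 'a set set \<Rightarrow> ('a set \<Rightarrow> real) \<Rightarrow> real \<Rightarrow> ('a \<Rightarrow> 'a \<Rightarrow> real) \<Rightarrow> bool" where
  "GW_polar_feasible V E z \<mu> Y \<longleftrightarrow>
     0 \<le> \<mu> \<and> psd_on V Y \<and> (\<forall>i\<in>V. Y i i = \<mu>) \<and>
     (\<forall>i j. {i, j} \<in> E \<longrightarrow> 1/4 * laplacian_adjoint Y i j \<ge> z {i, j})"

definition GW_polar :: "'a set \<Rightarrow> 'a set set \<Rightarrow> ('a set \<Rightarrow> real) \<Rightarrow> real" where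
  "GW_polar V E z = (LEAST \<mu>. \<exists>Y. GW_polar_feasible V E z \<mu> Y)"

definition alpha_GW :: real where
  "alpha_GW = (LEAST c. \<exists>\<theta>. 0 < \<theta> \<and> \<theta> \<le> pi \<and> c = 2 / pi * (\<theta> / (1 - cos \<theta>)))"

end

theory Submission
  imports Defs "HOL-Probability.Probability"
begin

text \<open>
  A fractional cut cover \<open>y\<close> yields the feasible matrix \<open>\<Sum>S. y S s\<^sub>S s\<^sub>S\<^sup>T\<close>, where
  \<open>s\<^sub>S\<close> is the \<open>\<plusminus>1\<close> vector of \<open>S\<close>; this is the first inequality. Conversely, an optimal
  matrix is the Gram matrix of vectors \<open>v i\<close> of equal length. For a standard Gaussian vector \<open>g\<close>
  the random set \<open>{i. v i \<bullet> g > 0}\<close> separates \<open>i\<close> and \<open>j\<close> with probability \<open>\<theta> / \<pi>\<close>,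
  \<open>\<theta>\<close> being the angle between \<open>v i\<close> and \<open>v j\<close>, and this is at least
  \<open>\<alpha> (1 - cos \<theta>) / 2\<close>. The distribution of the random set, scaled by \<open>\<mu> / \<alpha>\<close>, is
  therefore a fractional cut cover.
\<close>


section \<open>The standard Gaussian measure and its rotation invariance in the plane\<close>

definition std_gauss :: "real measure" where
  "std_gauss = density lborel std_normal_density"

lemma sets_std_gauss [simp, measurable_cong]: "sets std_gauss = sets borel"
  by (simp add: std_gauss_def)

lemma space_std_gauss [simp]: "space std_gauss = UNIV"
  by (simp add: std_gauss_def)

interpretation std_gauss: prob_space std_gauss
  unfolding std_gauss_def by (rule prob_space_normal_density) simp

interpretation std_gauss_prod: product_prob_space "\<lambda>_::nat. std_gauss" I for I
  by unfold_locales

lemma nn_integral_std_gauss: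
  "f \<in> borel_measurable borel \<Longrightarrow>
    (\<integral>\<^sup>+x. f x \<partial>std_gauss) = (\<integral>\<^sup>+x. ennreal (std_normal_density x) * f x \<partial>lborel)"
  unfolding std_gauss_def by (subst nn_integral_density) simp_all

text \<open>The product density depends on a point only through its distance from the origin. This
  is the density half of planar rotation invariance.\<close>

lemma std_normal_density_mult_eq:
  assumes "x\<^sup>2 + y\<^sup>2 = u\<^sup>2 + v\<^sup>2"
  shows "std_normal_density x * std_normal_density y = std_normal_density u * std_normal_density v"
proof -
  have "exp (- x\<^sup>2 / 2) * exp (- y\<^sup>2 / 2) = exp (- u\<^sup>2 / 2) * exp (- v\<^sup>2 / 2)"
    unfolding exp_add[symmetric] using assms by (simp add: field_simps)
  thus ?thesis by (simp add: std_normal_density_def)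
qed

lemma nn_integral_real_linear:
  fixes c :: real
  assumes [measurable]: "f \<in> borel_measurable borel" and c: "c \<noteq> 0"
  shows "(\<integral>\<^sup>+x. f (t + c * x) \<partial>lborel) = ennreal (1 / \<bar>c\<bar>) * (\<integral>\<^sup>+x. f x \<partial>lborel)"
  using c unfolding nn_integral_real_affine[OF assms, of t]
  by (simp add: mult.assoc[symmetric] ennreal_mult[symmetric])

text \<open>For \<open>c \<noteq> 0\<close> the rotation is done one variable at a time: substitute
  \<open>u = c * x + s * y\<close> at fixed \<open>y\<close>, exchange the integrals, then rescale
  \<open>y\<close> at fixed \<open>u\<close>. The factors \<open>1 / \<bar>c\<bar>\<close> and
  \<open>\<bar>c\<bar>\<close> cancel. For \<open>c = 0\<close> the rotation merely exchanges the
  axes up to signs.\<close>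

lemma lborel_rotation:
  fixes c s :: real
  assumes H [measurable]: "case_prod H \<in> borel_measurable (borel \<Otimes>\<^sub>M borel)"
    and cs: "c\<^sup>2 + s\<^sup>2 = 1"
  shows "(\<integral>\<^sup>+y. \<integral>\<^sup>+x. H (c * x + s * y) (c * y - s * x) \<partial>lborel \<partial>lborel)
    = (\<integral>\<^sup>+x. \<integral>\<^sup>+y. H x y \<partial>lborel \<partial>lborel)"
proof (cases "c = 0")
  case True
  hence s: "s \<noteq> 0" "\<bar>s\<bar> = 1" using cs by (auto simp: power2_eq_1_iff)
  have "(\<integral>\<^sup>+y. \<integral>\<^sup>+x. H (c * x + s * y) (c * y - s * x) \<partial>lborel \<partial>lborel)
    = (\<integral>\<^sup>+y. \<integral>\<^sup>+x. H (0 + s * y) (0 + (- s) * x) \<partial>lborel \<partial>lborel)"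
    using True by simp
  also have "\<dots> = (\<integral>\<^sup>+y. \<integral>\<^sup>+x. H (0 + s * y) x \<partial>lborel \<partial>lborel)"
    by (rule nn_integral_cong, subst nn_integral_real_linear[where c="- s"]) (use s in auto)
  also have "\<dots> = (\<integral>\<^sup>+y. \<integral>\<^sup>+x. H y x \<partial>lborel \<partial>lborel)"
    by (subst nn_integral_real_linear[where c=s]) (use s in auto)
  finally show ?thesis .
next
  case False
  have "(\<integral>\<^sup>+y. \<integral>\<^sup>+x. H (c * x + s * y) (c * y - s * x) \<partial>lborel \<partial>lborel)
    = (\<integral>\<^sup>+y. \<integral>\<^sup>+x. (\<lambda>u. H u (- s * u / c + 1 / c * y)) (s * y + c * x) \<partial>lborel \<partial>lborel)"
  proof (intro nn_integral_cong arg_cong2[where f=H])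
    fix x y :: real
    have "c * y - s * x = (- s * (s * y + c * x) + (c\<^sup>2 + s\<^sup>2) * y) / c"
      using False by (simp add: field_simps power2_eq_square)
    thus "c * y - s * x = - s * (s * y + c * x) / c + 1 / c * y"
      using False cs by (simp add: field_simps)
  qed simp
  also have "\<dots> = (\<integral>\<^sup>+y. ennreal (1 / \<bar>c\<bar>) * (\<integral>\<^sup>+u. H u (- s * u / c + 1 / c * y) \<partial>lborel) \<partial>lborel)"
    by (rule nn_integral_cong, subst nn_integral_real_linear) (use False in auto)
  also have "\<dots> = ennreal (1 / \<bar>c\<bar>) * (\<integral>\<^sup>+y. \<integral>\<^sup>+u. H u (- s * u / c + 1 / c * y) \<partial>lborel \<partial>lborel)"
    by (rule nn_integral_cmult) measurable
  also have "(\<integral>\<^sup>+y. \<integral>\<^sup>+u. H u (- s * u / c + 1 / c * y) \<partial>lborel \<partial>lborel)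
      = (\<integral>\<^sup>+u. \<integral>\<^sup>+y. H u (- s * u / c + 1 / c * y) \<partial>lborel \<partial>lborel)"
    by (rule lborel_pair.Fubini') measurable
  also have "\<dots> = (\<integral>\<^sup>+u. ennreal \<bar>c\<bar> * (\<integral>\<^sup>+y. H u y \<partial>lborel) \<partial>lborel)"
    by (rule nn_integral_cong, subst nn_integral_real_linear) (use False in auto)
  also have "\<dots> = ennreal \<bar>c\<bar> * (\<integral>\<^sup>+u. \<integral>\<^sup>+y. H u y \<partial>lborel \<partial>lborel)"
    by (rule nn_integral_cmult) measurable
  finally show ?thesis
    using False by (simp add: mult.assoc[symmetric] ennreal_mult[symmetric])
qed

lemma std_gauss_Fubini:
  assumes "case_prod F \<in> borel_measurable (borel \<Otimes>\<^sub>M borel)"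
  shows "(\<integral>\<^sup>+x. \<integral>\<^sup>+y. F x y \<partial>std_gauss \<partial>std_gauss) = (\<integral>\<^sup>+y. \<integral>\<^sup>+x. F x y \<partial>std_gauss \<partial>std_gauss)"
proof -
  interpret P: pair_sigma_finite std_gauss std_gauss by unfold_locales
  show ?thesis by (rule P.Fubini'[symmetric]) (use assms in measurable)
qed

lemma nn_integral_std_gauss2:
  assumes [measurable]: "case_prod F \<in> borel_measurable (borel \<Otimes>\<^sub>M borel)"
  shows "(\<integral>\<^sup>+x. \<integral>\<^sup>+y. F x y \<partial>std_gauss \<partial>std_gauss) =
    (\<integral>\<^sup>+x. \<integral>\<^sup>+y. ennreal (std_normal_density x * std_normal_density y) * F x y \<partial>lborel \<partial>lborel)"
proof -
  have "(\<integral>\<^sup>+x. \<integral>\<^sup>+y. F x y \<partial>std_gauss \<partial>std_gauss) =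
      (\<integral>\<^sup>+x. \<integral>\<^sup>+y. ennreal (std_normal_density y) * F x y \<partial>lborel \<partial>std_gauss)"
    by (intro nn_integral_cong nn_integral_std_gauss) measurable
  also have "\<dots> = (\<integral>\<^sup>+x. ennreal (std_normal_density x) * 
      (\<integral>\<^sup>+y. ennreal (std_normal_density y) * F x y \<partial>lborel) \<partial>lborel)"
    by (intro nn_integral_std_gauss) measurable
  also have "\<dots> = (\<integral>\<^sup>+x. \<integral>\<^sup>+y. ennreal (std_normal_density x * std_normal_density y) * F x y \<partial>lborel \<partial>lborel)"
    by (intro nn_integral_cong, subst nn_integral_cmult[symmetric])
      (auto simp: ennreal_mult mult.assoc)
  finally show ?thesis .
qed

text \<open>The density is absorbed into the integrand \<open>H\<close>. Since the product density
  is itself invariant under the rotation, invariance of Lebesgue measure applied to \<open>H\<close>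
  suffices.\<close>

lemma std_gauss_rotation:
  fixes c s :: real
  assumes F [measurable]: "case_prod F \<in> borel_measurable (borel \<Otimes>\<^sub>M borel)"
    and cs: "c\<^sup>2 + s\<^sup>2 = 1"
  shows "(\<integral>\<^sup>+x. \<integral>\<^sup>+y. F (c * x + s * y) (c * y - s * x) \<partial>std_gauss \<partial>std_gauss)
    = (\<integral>\<^sup>+x. \<integral>\<^sup>+y. F x y \<partial>std_gauss \<partial>std_gauss)"
proof -
  define H where "H x y = ennreal (std_normal_density x * std_normal_density y) * F x y" for x y
  have Hm [measurable]: "case_prod H \<in> borel_measurable (borel \<Otimes>\<^sub>M borel)"
    unfolding H_def by measurable
  have sq: "(c * x + s * y)\<^sup>2 + (c * y - s * x)\<^sup>2 = x\<^sup>2 + y\<^sup>2" for x y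
  proof -
    have "(c * x + s * y)\<^sup>2 + (c * y - s * x)\<^sup>2 = (c\<^sup>2 + s\<^sup>2) * (x\<^sup>2 + y\<^sup>2)"
      by (simp add: power2_eq_square algebra_simps)
    thus ?thesis using cs by simp
  qed
  have "(\<integral>\<^sup>+x. \<integral>\<^sup>+y. F (c * x + s * y) (c * y - s * x) \<partial>std_gauss \<partial>std_gauss)
    = (\<integral>\<^sup>+x. \<integral>\<^sup>+y. H (c * x + s * y) (c * y - s * x) \<partial>lborel \<partial>lborel)"
    by (subst nn_integral_std_gauss2)
      (auto intro!: nn_integral_cong simp: H_def std_normal_density_mult_eq[OF sq])
  also have "\<dots> = (\<integral>\<^sup>+y. \<integral>\<^sup>+x. H (c * x + s * y) (c * y - s * x) \<partial>lborel \<partial>lborel)"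
    by (rule lborel_pair.Fubini'[symmetric]) measurable
  also have "\<dots> = (\<integral>\<^sup>+x. \<integral>\<^sup>+y. H x y \<partial>lborel \<partial>lborel)"
    by (rule lborel_rotation[OF Hm cs])
  also have "\<dots> = (\<integral>\<^sup>+x. \<integral>\<^sup>+y. F x y \<partial>std_gauss \<partial>std_gauss)"
    by (subst nn_integral_std_gauss2) (auto simp: H_def[abs_def])
  finally show ?thesis .
qed

lemma std_gauss_reflection:
  assumes [measurable]: "f \<in> borel_measurable borel"
  shows "(\<integral>\<^sup>+x. f (- x) \<partial>std_gauss) = (\<integral>\<^sup>+x. f x \<partial>std_gauss)"
proof -
  have "(\<integral>\<^sup>+x. f (- x) \<partial>std_gauss)
      = (\<integral>\<^sup>+x. (\<lambda>x. ennreal (std_normal_density x) * f x) (0 + (- 1) * x) \<partial>lborel)"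
    by (subst nn_integral_std_gauss) (auto simp: std_normal_density_def)
  also have "\<dots> = (\<integral>\<^sup>+x. f x \<partial>std_gauss)"
    by (subst nn_integral_real_linear) (auto simp: nn_integral_std_gauss)
  finally show ?thesis .
qed

section \<open>The joint law of two linear forms in a Gaussian vector\<close>

text \<open>Polar coordinates in algebraic form: \<open>a * x + b * z\<close> becomes
  \<open>r\<close> times the single rotated coordinate \<open>c * x + s * z\<close>. The origin is
  included, with \<open>r = 0\<close>.\<close>

lemma ex_rotation_to_axis:
  fixes a b :: real
  obtains c s r where "c\<^sup>2 + s\<^sup>2 = 1" "0 \<le> r" "a = r * c" "b = r * s" "r\<^sup>2 = a\<^sup>2 + b\<^sup>2"
proof -
  obtain t where "(a, b) = (norm (a, b) * cos t, norm (a, b) * sin t)" 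
  proof -
    have "Complex a b = rcis (cmod (Complex a b)) (Arg (Complex a b))" by (simp add: rcis_cmod_Arg)
    hence "a = norm (a, b) * cos (Arg (Complex a b))" "b = norm (a, b) * sin (Arg (Complex a b))"
      by (simp_all add: complex_eq_iff norm_Pair cmod_def)
    thus ?thesis using that by blast
  qed
  thus ?thesis
    by (intro that[of "cos t" "sin t" "norm (a, b)"]) (auto simp: norm_Pair)
qed

lemma PiM_fun_upd_sum:
  "(\<Sum>k<Suc n. a k * (g(n := y)) k) = (\<Sum>k<n. a k * g k) + a n * (y::real)"
  by (auto intro!: sum.cong)

text \<open>
  The law of a pair of linear statistics of a Gaussian vector. Adding a coordinate, \<open>\<alpha> x + a n z\<close>
  and \<open>\<beta> x + \<gamma> y + b n z\<close> are brought back to the two-variable triangular form by one rotation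
  of \<open>(x, z)\<close> and one of \<open>(y, z)\<close>, so only planar rotation invariance is needed.
\<close>

lemma gauss_pair_law:
  fixes a b :: "nat \<Rightarrow> real"
  shows "\<exists>\<alpha> \<beta> \<gamma>. 0 \<le> \<alpha> \<and> 0 \<le> \<gamma> \<and> \<alpha>\<^sup>2 = (\<Sum>k<n. a k * a k) \<and> \<alpha> * \<beta> = (\<Sum>k<n. a k * b k)
    \<and> \<beta>\<^sup>2 + \<gamma>\<^sup>2 = (\<Sum>k<n. b k * b k)
    \<and> (\<forall>F. case_prod F \<in> borel_measurable (borel \<Otimes>\<^sub>M borel) \<longrightarrow>
        (\<integral>\<^sup>+g. F (\<Sum>k<n. a k * g k) (\<Sum>k<n. b k * g k) \<partial>PiM {..<n} (\<lambda>_. std_gauss))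
        = (\<integral>\<^sup>+x. \<integral>\<^sup>+y. F (\<alpha> * x) (\<beta> * x + \<gamma> * y) \<partial>std_gauss \<partial>std_gauss))"
proof (induction n)
  case 0
  have "(\<integral>\<^sup>+g. F (\<Sum>k<0. a k * g k) (\<Sum>k<0. b k * g k) \<partial>PiM {..<0} (\<lambda>_. std_gauss))
        = (\<integral>\<^sup>+x. \<integral>\<^sup>+y. F (0 * x) (0 * x + 0 * y) \<partial>std_gauss \<partial>std_gauss)" for F :: "real \<Rightarrow> real \<Rightarrow> ennreal"
    by (simp add: std_gauss.emeasure_space_1[simplified] std_gauss_prod.emeasure_space_1)
  thus ?case by (intro exI[of _ 0]) auto
next
  case (Suc n)
  then obtain \<alpha> \<beta> \<gamma> where nn: "0 \<le> \<alpha>" "0 \<le> \<gamma>" and sq: "\<alpha>\<^sup>2 = (\<Sum>k<n. a k * a k)"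
    "\<alpha> * \<beta> = (\<Sum>k<n. a k * b k)" "\<beta>\<^sup>2 + \<gamma>\<^sup>2 = (\<Sum>k<n. b k * b k)"
    and IH: "\<And>F. case_prod F \<in> borel_measurable (borel \<Otimes>\<^sub>M borel) \<Longrightarrow>
        (\<integral>\<^sup>+g. F (\<Sum>k<n. a k * g k) (\<Sum>k<n. b k * g k) \<partial>PiM {..<n} (\<lambda>_. std_gauss))
        = (\<integral>\<^sup>+x. \<integral>\<^sup>+y. F (\<alpha> * x) (\<beta> * x + \<gamma> * y) \<partial>std_gauss \<partial>std_gauss)" by blast
  obtain c s r where r: "c\<^sup>2 + s\<^sup>2 = 1" "0 \<le> r" "\<alpha> = r * c" "a n = r * s" "r\<^sup>2 = \<alpha>\<^sup>2 + (a n)\<^sup>2"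
    by (rule ex_rotation_to_axis)
  \<comment> \<open>\<open>\<beta>'\<close> and \<open>\<delta>\<close> are the coefficients of the
    second form in the rotated variables \<open>u = c * x + s * z\<close> and
    \<open>v = c * z - s * x\<close>. The first form is \<open>r * u\<close>, so \<open>v\<close>
    enters only the second one and can be merged with \<open>y\<close> by the next rotation.\<close>
  define \<beta>' where "\<beta>' = \<beta> * c + b n * s"
  define \<delta> where "\<delta> = b n * c - \<beta> * s"
  obtain c' s' q where q: "c'\<^sup>2 + s'\<^sup>2 = 1" "0 \<le> q" "\<gamma> = q * c'" "\<delta> = q * s'" "q\<^sup>2 = \<gamma>\<^sup>2 + \<delta>\<^sup>2"
    by (rule ex_rotation_to_axis)
  have \<beta>: "\<beta> = \<beta>' * c - \<delta> * s"
  proof -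
    have "\<beta>' * c - \<delta> * s = (c\<^sup>2 + s\<^sup>2) * \<beta>" by (simp add: \<beta>'_def \<delta>_def power2_eq_square algebra_simps)
    thus ?thesis using r by simp
  qed
  have bn: "b n = \<beta>' * s + \<delta> * c"
  proof -
    have "\<beta>' * s + \<delta> * c = (c\<^sup>2 + s\<^sup>2) * b n" by (simp add: \<beta>'_def \<delta>_def power2_eq_square algebra_simps)
    thus ?thesis using r by simp
  qed
  have "r\<^sup>2 = (\<Sum>k<Suc n. a k * a k)" using r sq by (simp add: power2_eq_square)
  moreover have "r * \<beta>' = (\<Sum>k<Suc n. a k * b k)"
  proof -
    have "r * \<beta>' = \<alpha> * \<beta> + a n * b n" by (simp add: \<beta>'_def r algebra_simps)
    thus ?thesis using sq by simp
  qed
  moreover have "\<beta>'\<^sup>2 + q\<^sup>2 = (\<Sum>k<Suc n. b k * b k)"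
  proof -
    have "\<beta>\<^sup>2 + (b n)\<^sup>2 = (c\<^sup>2 + s\<^sup>2) * (\<beta>'\<^sup>2 + \<delta>\<^sup>2)"
      unfolding \<beta> bn by (simp add: power2_eq_square algebra_simps)
    hence "\<beta>\<^sup>2 + (b n)\<^sup>2 = \<beta>'\<^sup>2 + \<delta>\<^sup>2" using r by simp
    thus ?thesis using sq q by (simp add: power2_eq_square)
  qed
  moreover have "(\<integral>\<^sup>+g. F (\<Sum>k<Suc n. a k * g k) (\<Sum>k<Suc n. b k * g k) \<partial>PiM {..<Suc n} (\<lambda>_. std_gauss))
        = (\<integral>\<^sup>+x. \<integral>\<^sup>+y. F (r * x) (\<beta>' * x + q * y) \<partial>std_gauss \<partial>std_gauss)"
    if F [measurable]: "case_prod F \<in> borel_measurable (borel \<Otimes>\<^sub>M borel)" for F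
  proof -
    have "(\<integral>\<^sup>+g. F (\<Sum>k<Suc n. a k * g k) (\<Sum>k<Suc n. b k * g k) \<partial>PiM {..<Suc n} (\<lambda>_. std_gauss))
      = (\<integral>\<^sup>+g. \<integral>\<^sup>+z. F ((\<Sum>k<n. a k * g k) + a n * z) ((\<Sum>k<n. b k * g k) + b n * z)
          \<partial>std_gauss \<partial>PiM {..<n} (\<lambda>_. std_gauss))"
      unfolding lessThan_Suc[of n]
      by (subst std_gauss_prod.product_nn_integral_insert)
        (auto simp: lessThan_Suc[symmetric] PiM_fun_upd_sum simp del: fun_upd_apply sum.lessThan_Suc intro!: nn_integral_cong)
    also have "\<dots> = (\<integral>\<^sup>+x. \<integral>\<^sup>+y. \<integral>\<^sup>+z. F (\<alpha> * x + a n * z) (\<beta> * x + \<gamma> * y + b n * z)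
          \<partial>std_gauss \<partial>std_gauss \<partial>std_gauss)"
      by (rule IH[of "\<lambda>u v. \<integral>\<^sup>+z. F (u + a n * z) (v + b n * z) \<partial>std_gauss"]) measurable
    \<comment> \<open>The rotation invariance acts on the two innermost integrals, so
      \<open>y\<close> moves outside to make \<open>x\<close> and \<open>z\<close> adjacent; a
      second exchange below does the same for \<open>y\<close> and \<open>v\<close>.\<close>
    also have "\<dots> = (\<integral>\<^sup>+y. \<integral>\<^sup>+x. \<integral>\<^sup>+z. F (\<alpha> * x + a n * z) (\<beta> * x + \<gamma> * y + b n * z)
          \<partial>std_gauss \<partial>std_gauss \<partial>std_gauss)"
      by (rule std_gauss_Fubini) measurable
    also have "\<dots> = (\<integral>\<^sup>+y. \<integral>\<^sup>+x. \<integral>\<^sup>+z. (\<lambda>u v. F (r * u) (\<beta>' * u + \<gamma> * y + \<delta> * v)) (c * x + s * z) (c * z - s * x)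
          \<partial>std_gauss \<partial>std_gauss \<partial>std_gauss)"
      unfolding \<beta> bn r by (simp add: algebra_simps)
    also have "\<dots> = (\<integral>\<^sup>+y. \<integral>\<^sup>+u. \<integral>\<^sup>+v. F (r * u) (\<beta>' * u + \<gamma> * y + \<delta> * v)
          \<partial>std_gauss \<partial>std_gauss \<partial>std_gauss)"
      by (intro nn_integral_cong std_gauss_rotation[OF _ r(1)]) measurable
    also have "\<dots> = (\<integral>\<^sup>+u. \<integral>\<^sup>+y. \<integral>\<^sup>+v. F (r * u) (\<beta>' * u + \<gamma> * y + \<delta> * v)
          \<partial>std_gauss \<partial>std_gauss \<partial>std_gauss)"
      by (rule std_gauss_Fubini) measurable
    also have "\<dots> = (\<integral>\<^sup>+u. \<integral>\<^sup>+y. \<integral>\<^sup>+v. (\<lambda>w _. F (r * u) (\<beta>' * u + q * w)) (c' * y + s' * v) (c' * v - s' * y)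
          \<partial>std_gauss \<partial>std_gauss \<partial>std_gauss)"
      unfolding q by (simp add: algebra_simps)
    \<comment> \<open>After the second rotation the integrand ignores the last variable, whose
      integral then drops out because the measure has total mass 1.\<close>
    also have "\<dots> = (\<integral>\<^sup>+u. \<integral>\<^sup>+w. \<integral>\<^sup>+_. F (r * u) (\<beta>' * u + q * w)
          \<partial>std_gauss \<partial>std_gauss \<partial>std_gauss)"
      by (intro nn_integral_cong std_gauss_rotation[OF _ q(1)]) measurable
    finally show ?thesis
      by (simp add: std_gauss.emeasure_space_1[simplified])
  qed
  ultimately show ?case using r(2) q(2) by blast
qed

section \<open>Gaussian measure of planar wedges\<close>

abbreviation gauss_plane :: "(real \<times> real) measure" where
  "gauss_plane \<equiv> std_gauss \<Otimes>\<^sub>M std_gauss"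

interpretation gauss_plane: prob_space gauss_plane
proof -
  interpret pair_prob_space std_gauss std_gauss ..
  show "prob_space gauss_plane" by unfold_locales
qed

lemma sets_gauss_plane: "sets gauss_plane = sets (borel \<Otimes>\<^sub>M borel)"
  by (rule sets_pair_measure_cong) simp_all

lemma gauss_plane_rotation:
  fixes c s :: real
  assumes A: "A \<in> sets gauss_plane" and cs: "c\<^sup>2 + s\<^sup>2 = 1"
  shows "measure gauss_plane {(x, y). (c * x + s * y, c * y - s * x) \<in> A} = measure gauss_plane A"
proof -
  have A' [measurable]: "A \<in> sets (borel \<Otimes>\<^sub>M borel)" using A by (simp add: sets_gauss_plane)
  have B: "{(x, y). (c * x + s * y, c * y - s * x) \<in> A} \<in> sets gauss_plane"
  proof -
    have "{p \<in> space (borel \<Otimes>\<^sub>M borel). (c * fst p + s * snd p, c * snd p - s * fst p) \<in> A} \<in> sets (borel \<Otimes>\<^sub>M borel)"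
      by measurable
    thus ?thesis by (simp add: sets_gauss_plane space_pair_measure case_prod_unfold)
  qed
  have "emeasure gauss_plane {(x, y). (c * x + s * y, c * y - s * x) \<in> A}
      = (\<integral>\<^sup>+x. \<integral>\<^sup>+y. indicator A (c * x + s * y, c * y - s * x) \<partial>std_gauss \<partial>std_gauss)"
    by (subst std_gauss.emeasure_pair_measure[OF B]) (simp add: indicator_def)
  also have "\<dots> = (\<integral>\<^sup>+x. \<integral>\<^sup>+y. indicator A (x, y) \<partial>std_gauss \<partial>std_gauss)"
    by (rule std_gauss_rotation[OF _ cs]) measurable
  also have "\<dots> = emeasure gauss_plane A"
    by (subst std_gauss.emeasure_pair_measure[OF A]) simp
  finally show ?thesis by (simp add: measure_def)
qed

lemma gauss_plane_reflection:
  assumes A: "A \<in> sets gauss_plane"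
  shows "measure gauss_plane {(x, y). (x, - y) \<in> A} = measure gauss_plane A"
proof -
  have A' [measurable]: "A \<in> sets (borel \<Otimes>\<^sub>M borel)" using A by (simp add: sets_gauss_plane)
  have B: "{(x, y). (x, - y) \<in> A} \<in> sets gauss_plane"
  proof -
    have "{p \<in> space (borel \<Otimes>\<^sub>M borel). (fst p, - snd p) \<in> A} \<in> sets (borel \<Otimes>\<^sub>M borel)"
      by measurable
    thus ?thesis by (simp add: sets_gauss_plane space_pair_measure case_prod_unfold)
  qed
  have "emeasure gauss_plane {(x, y). (x, - y) \<in> A}
      = (\<integral>\<^sup>+x. \<integral>\<^sup>+y. indicator A (x, - y) \<partial>std_gauss \<partial>std_gauss)"
    by (subst std_gauss.emeasure_pair_measure[OF B]) (simp add: indicator_def)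
  also have "\<dots> = (\<integral>\<^sup>+x. \<integral>\<^sup>+y. indicator A (x, y) \<partial>std_gauss \<partial>std_gauss)"
    by (rule nn_integral_cong, rule std_gauss_reflection) measurable
  also have "\<dots> = emeasure gauss_plane A"
    by (subst std_gauss.emeasure_pair_measure[OF A]) simp
  finally show ?thesis by (simp add: measure_def)
qed

lemma gauss_plane_origin: "measure gauss_plane {(0, 0)} = 0"
proof -
  have "emeasure std_gauss {0} = 0"
    unfolding std_gauss_def by (subst emeasure_density) (auto simp: nn_integral_null_set)
  hence "emeasure gauss_plane ({0} \<times> {0}) = 0"
    by (subst std_gauss.emeasure_pair_measure_Times) auto
  thus ?thesis by (simp add: measure_def)
qed

text \<open>The event that the unit vector at angle \<open>s\<close> is rounded to the positive side
  and the one at angle \<open>t\<close> is not. Having one strict and one weak inequality matches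
  the complement of a strict sign test and makes wedges that share a boundary line disjoint.\<close>

definition wedge :: "real \<Rightarrow> real \<Rightarrow> (real \<times> real) set" where
  "wedge s t = {(x, y). 0 < x * cos s + y * sin s \<and> x * cos t + y * sin t \<le> 0}"

lemma wedge_sets [measurable]: "wedge s t \<in> sets gauss_plane"
proof -
  have "{p \<in> space (borel \<Otimes>\<^sub>M borel). 0 < fst p * cos s + snd p * sin s \<and> fst p * cos t + snd p * sin t \<le> 0}
      \<in> sets (borel \<Otimes>\<^sub>M borel)" by measurable
  thus ?thesis by (simp add: sets_gauss_plane wedge_def space_pair_measure case_prod_unfold)
qed

lemma measure_wedge_shift: "measure gauss_plane (wedge (s + r) (t + r)) = measure gauss_plane (wedge s t)"
proof -
  have "wedge (s + r) (t + r) = {(x, y). (cos r * x + sin r * y, cos r * y - sin r * x) \<in> wedge s t}"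
    by (auto simp: wedge_def cos_add sin_add algebra_simps)
  thus ?thesis using gauss_plane_rotation[OF wedge_sets, of "cos r" "sin r" s t] by simp
qed

text \<open>Reflection in the horizontal axis carries \<open>wedge 0 t\<close> to
  \<open>wedge 0 (- t)\<close>, and rotation by \<open>t\<close> carries that to
  \<open>wedge t 0\<close>.\<close>

lemma measure_wedge_swap: "measure gauss_plane (wedge t 0) = measure gauss_plane (wedge 0 t)"
proof -
  have "wedge 0 t = {(x, y). (x, - y) \<in> wedge 0 (- t)}"
    by (auto simp: wedge_def)
  hence "measure gauss_plane (wedge 0 t) = measure gauss_plane (wedge 0 (- t))"
    using gauss_plane_reflection[OF wedge_sets, of 0 "- t"] by simp
  thus ?thesis using measure_wedge_shift[of 0 t "- t"] by simp
qed

text \<open>The unit vector at angle \<open>s\<close> is a positive combination of those at angles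
  \<open>0\<close> and \<open>t\<close> when \<open>0 < s < t < pi\<close>; the identity
  \<open>lin\<close> states this with sines as coefficients. It settles the inclusion of the union
  in the large wedge. At \<open>t = pi\<close> the boundary rays would no longer match.\<close>

lemma wedge_split:
  assumes "0 \<le> s" "s \<le> t" "t < pi"
  shows "wedge 0 t = wedge 0 s \<union> wedge s t"
proof (cases "s = 0 \<or> s = t")
  case True
  thus ?thesis by (auto simp: wedge_def)
next
  case False
  hence st: "0 < s" "s < t" using assms by auto
  have pos: "0 < sin s" "0 < sin t" "0 < sin (t - s)"
    using st assms by (auto intro!: sin_gt_zero)
  have lin: "sin t * (x * cos s + y * sin s) = sin (t - s) * x + sin s * (x * cos t + y * sin t)" for x y
    by (simp add: sin_diff algebra_simps)
  show ?thesis
  proof (intro equalityI subsetI)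
    fix p assume "p \<in> wedge 0 t"
    thus "p \<in> wedge 0 s \<union> wedge s t" by (auto simp: wedge_def)
  next
    fix p assume p: "p \<in> wedge 0 s \<union> wedge s t"
    obtain x y where xy: "p = (x, y)" by (cases p)
    define a where "a = x * cos s + y * sin s"
    define b where "b = x * cos t + y * sin t"
    have ab: "sin t * a = sin (t - s) * x + sin s * b" unfolding a_def b_def by (rule lin)
    have "0 < x \<and> b \<le> 0"
    proof (cases "0 < x \<and> a \<le> 0")
      case True
      hence "sin t * a \<le> 0" "0 < sin (t - s) * x" using pos by (auto simp: mult_nonneg_nonpos)
      hence "sin s * b < 0" using ab by linarith
      thus ?thesis using True pos by (auto simp: mult_less_0_iff)
    next
      case False
      hence "0 < a" "b \<le> 0" using p unfolding xy a_def b_def by (auto simp: wedge_def)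
      hence "0 < sin t * a" "sin s * b \<le> 0" using pos by (auto simp: mult_nonneg_nonpos)
      hence "0 < sin (t - s) * x" using ab by linarith
      thus ?thesis using \<open>b \<le> 0\<close> pos by (simp add: zero_less_mult_iff)
    qed
    thus "p \<in> wedge 0 t" by (simp add: xy wedge_def b_def)
  qed
qed

text \<open>Split the wedge at angle \<open>s\<close> and rotate the second piece back by
  \<open>s\<close>.\<close>

lemma measure_wedge_add:
  assumes "0 \<le> s" "0 \<le> t" "s + t < pi"
  shows "measure gauss_plane (wedge 0 (s + t)) = measure gauss_plane (wedge 0 s) + measure gauss_plane (wedge 0 t)"
proof -
  have "measure gauss_plane (wedge 0 (s + t)) = measure gauss_plane (wedge 0 s \<union> wedge s (s + t))"
    by (subst wedge_split[of s "s + t"]) (use assms in auto)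
  also have "\<dots> = measure gauss_plane (wedge 0 s) + measure gauss_plane (wedge s (s + t))"
    by (rule gauss_plane.finite_measure_Union[OF wedge_sets wedge_sets]) (auto simp: wedge_def)
  also have "measure gauss_plane (wedge s (s + t)) = measure gauss_plane (wedge 0 t)"
    using measure_wedge_shift[of 0 s t] by (simp add: add.commute)
  finally show ?thesis .
qed

text \<open>Four rotated copies of the half-open quarter plane are disjoint, have equal mass and
  cover everything but the origin, a null set.\<close>

lemma measure_wedge_quarter: "measure gauss_plane (wedge 0 (pi / 2)) = 1 / 4"
proof -
  define Q where "Q k = wedge (real k * (pi / 2)) (pi / 2 + real k * (pi / 2))" for k :: nat
  have Q: "measure gauss_plane (Q k) = measure gauss_plane (wedge 0 (pi / 2))" for k
    unfolding Q_def using measure_wedge_shift[of 0 "real k * (pi / 2)" "pi / 2"] by simp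
  have Q0: "Q 0 = {(x, y). 0 < x \<and> y \<le> 0}" by (auto simp: Q_def wedge_def)
  have Q1: "Q 1 = {(x, y). 0 < y \<and> 0 \<le> x}" by (auto simp: Q_def wedge_def)
  have e: "real 2 * (pi / 2) = pi" "real 3 * (pi / 2) = pi + pi / 2" "pi / 2 + (pi + pi / 2) = 2 * pi"
    by simp_all
  have c: "cos (3 * pi / 2) = 0" "sin (3 * pi / 2) = - 1"
    using cos_3over2_pi sin_3over2_pi by simp_all
  have Q2: "Q 2 = {(x, y). x < 0 \<and> 0 \<le> y}" unfolding Q_def wedge_def e by (auto simp: c)
  have Q3: "Q 3 = {(x, y). y < 0 \<and> x \<le> 0}" unfolding Q_def wedge_def e by (auto simp: c)
  have Qs: "Q k \<in> sets gauss_plane" for k unfolding Q_def by (rule wedge_sets)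
  have "measure gauss_plane (space gauss_plane - {(0, 0)}) = measure gauss_plane ((Q 0 \<union> Q 1) \<union> (Q 2 \<union> Q 3))"
    by (rule arg_cong[where f="measure gauss_plane"]) (auto simp: Q0 Q1 Q2 Q3 space_pair_measure simp del: One_nat_def)
  also have "\<dots> = measure gauss_plane (Q 0 \<union> Q 1) + measure gauss_plane (Q 2 \<union> Q 3)"
    by (rule gauss_plane.finite_measure_Union[OF sets.Un[OF Qs Qs] sets.Un[OF Qs Qs]]) (auto simp: Q0 Q1 Q2 Q3 simp del: One_nat_def)
  also have "measure gauss_plane (Q 0 \<union> Q 1) = measure gauss_plane (Q 0) + measure gauss_plane (Q 1)"
    by (rule gauss_plane.finite_measure_Union[OF Qs Qs]) (auto simp: Q0 Q1 Q2 Q3 simp del: One_nat_def)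
  also have "measure gauss_plane (Q 2 \<union> Q 3) = measure gauss_plane (Q 2) + measure gauss_plane (Q 3)"
    by (rule gauss_plane.finite_measure_Union[OF Qs Qs]) (auto simp: Q0 Q1 Q2 Q3 simp del: One_nat_def)
  also have "measure gauss_plane (space gauss_plane - {(0, 0)}) = 1"
  proof -
    have "{(0, 0)} \<in> sets gauss_plane"
      using pair_measureI[of "{0::real}" std_gauss "{0::real}" std_gauss] by simp
    thus ?thesis by (subst gauss_plane.prob_compl) (simp_all add: gauss_plane_origin)
  qed
  finally show ?thesis unfolding Q by simp
qed

text \<open>
  Equality holds, but the lower bound suffices and follows from additivity, monotonicity and
  the quarter plane.
\<close>

lemma measure_wedge_ge:
  assumes t: "0 \<le> t" "t \<le> pi"
  shows "t / (2 * pi) \<le> measure gauss_plane (wedge 0 t)"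
proof -
  define f where "f t = measure gauss_plane (wedge 0 t)" for t
  have below: "u / (2 * pi) \<le> f u" if u: "0 \<le> u" "u < pi" for u
  proof (rule field_le_epsilon)
    fix \<epsilon> :: real assume "0 < \<epsilon>"
    then obtain m :: nat where m: "0 < m" "1 / real m < \<epsilon>"
      using real_arch_inverse[of \<epsilon>] by (auto simp: inverse_eq_divide)
    \<comment> \<open>This mesh cuts the quarter plane into \<open>m\<close> equal wedges, so
      additivity gives \<open>f h\<close> the exact value \<open>1 / (4 * m)\<close>.\<close>
    define h where "h = pi / (2 * real m)"
    have h: "0 < h" using m by (simp add: h_def)
    have mult: "f (real k * h) = real k * f h" if "real k * h < pi" for k
      using that
    proof (induction k)
      case 0
      have "f 0 = 0" unfolding f_def wedge_def
        by (rule trans[OF arg_cong[where f="measure gauss_plane"] measure_empty]) auto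
      thus ?case by simp
    next
      case (Suc k)
      have *: "real k * h + h < pi" using Suc.prems by (simp add: algebra_simps)
      hence "real k * h < pi" using h by linarith
      moreover have "f (real k * h + h) = f (real k * h) + f h"
        unfolding f_def by (rule measure_wedge_add) (use h * in auto)
      ultimately show ?case using Suc.IH by (simp add: algebra_simps)
    qed
    have "real m * h = pi / 2" using m by (simp add: h_def)
    moreover have "pi / 2 < pi" by simp
    ultimately have "f (pi / 2) = real m * f h" using mult[of m] by metis
    hence fh: "real m * f h = 1 / 4" using measure_wedge_quarter by (simp add: f_def)
    \<comment> \<open>The \<open>k\<close> whole mesh wedges that fit below \<open>u\<close> bound
      \<open>f u\<close> from below. The angle left over is less than \<open>h\<close>, which costs
      at most \<open>1 / (4 * m)\<close>, within \<epsilon>.\<close>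
    define k where "k = nat \<lfloor>u / h\<rfloor>"
    have k: "real k \<le> u / h" "u / h < real k + 1"
      using u h by (auto simp: k_def)
    hence kh: "real k * h \<le> u" "u < real k * h + h"
      using h by (auto simp: field_simps)
    have "real k * f h = f (real k * h)" using mult[of k] kh u by simp
    also have "\<dots> \<le> f u"
      unfolding f_def
      by (rule gauss_plane.finite_measure_mono[OF _ wedge_sets], subst wedge_split[of "real k * h" u])
        (use kh u h in auto)
    finally have "real k * f h \<le> f u" .
    moreover have "u / (2 * pi) \<le> real k * f h + 1 / real m"
    proof -
      have "u / (2 * pi) \<le> (real k * h + h) / (2 * pi)"
        using kh by (intro divide_right_mono) auto
      also have "\<dots> = (real k + 1) * (1 / 4) / real m"
        using m by (simp add: h_def field_simps)
      also have "\<dots> = real k * f h + 1 / 4 / real m"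
        using m unfolding fh[symmetric] by (simp add: field_simps)
      also have "\<dots> \<le> real k * f h + 1 / real m"
        using m by (simp add: field_simps)
      finally show ?thesis .
    qed
    ultimately show "u / (2 * pi) \<le> f u + \<epsilon>" using m by linarith
  qed
  show ?thesis
  proof (cases "t = pi")
    case False
    thus ?thesis using below[of t] t by (simp add: f_def)
  next
    case True
    \<comment> \<open>Additivity stops short of \<open>pi\<close>, so the half plane
      \<open>wedge 0 pi\<close> is bounded by the smaller wedges inside it as their angle tends to
      \<open>pi\<close>.\<close>
    have "1 / 2 \<le> f pi"
    proof (rule field_le_epsilon)
      fix \<epsilon> :: real assume e: "0 < \<epsilon>"
      define u where "u = max 0 (pi - 2 * pi * \<epsilon>)"
      have u: "0 \<le> u" "u < pi" using e by (auto simp: u_def)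
      have "1 / 2 - \<epsilon> \<le> u / (2 * pi)" by (simp add: u_def max_def field_simps)
      also have "\<dots> \<le> f u" by (rule below[OF u])
      also have "\<dots> \<le> f pi"
        unfolding f_def
        by (intro gauss_plane.finite_measure_mono wedge_sets) (auto simp: wedge_def)
      finally show "1 / 2 \<le> f pi + \<epsilon>" by simp
    qed
    thus ?thesis using True by (simp add: f_def)
  qed
qed


section \<open>The constant \<open>alpha_GW\<close>\<close>

text \<open>\<open>LEAST\<close> is informative only once the minimum is known to be attained.
  Compactness gives a minimiser on \<open>{1..pi}\<close>. On angles up to 1 the estimate
  \<open>1 - cos \<theta> \<le> \<theta> / 2\<close> makes the quotient at least
  \<open>4 / pi\<close>, which exceeds its value 1 at \<open>pi\<close>, so the minimiser is
  global.\<close>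

lemma
  shows alpha_GW_pos: "0 < alpha_GW"
    and alpha_GW_le: "\<And>\<theta>. 0 < \<theta> \<Longrightarrow> \<theta> \<le> pi \<Longrightarrow> alpha_GW \<le> 2 / pi * (\<theta> / (1 - cos \<theta>))"
proof -
  define h where "h \<theta> = 2 / pi * (\<theta> / (1 - cos \<theta>))" for \<theta> :: real
  have cos1: "cos \<theta> < 1" if "0 < \<theta>" "\<theta> \<le> pi" for \<theta> :: real
    using cos_monotone_0_pi[of 0 \<theta>] that by simp
  have "\<forall>\<theta>\<in>{1..pi}. 1 - cos \<theta> \<noteq> 0" 
  proof
    fix \<theta> :: real assume "\<theta> \<in> {1..pi}"
    hence "0 < \<theta>" "\<theta> \<le> pi" by simp_all
    from cos1[OF this] show "1 - cos \<theta> \<noteq> 0" by simp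
  qed
  hence "continuous_on {1..pi} h"
    unfolding h_def by (intro continuous_on_mult continuous_on_divide continuous_on_diff continuous_on_const
        continuous_on_id continuous_on_cos)
  moreover have "{1..pi} \<noteq> {}" using pi_gt3 by auto
  ultimately obtain m where m: "m \<in> {1..pi}" "\<And>\<theta>. \<theta> \<in> {1..pi} \<Longrightarrow> h m \<le> h \<theta>"
    using continuous_attains_inf[of "{1..pi}" h] by (auto simp: compact_Icc)
  have small: "h pi \<le> h \<theta>" if \<theta>: "0 < \<theta>" "\<theta> \<le> 1" for \<theta>
  proof -
    have "1 - cos \<theta> = 2 * (sin (\<theta> / 2))\<^sup>2" using cos_double_sin[of "\<theta> / 2"] by simp
    also have "\<dots> \<le> 2 * (\<theta> / 2)\<^sup>2"
    proof -
      have "\<bar>sin (\<theta> / 2)\<bar> \<le> \<bar>\<theta> / 2\<bar>" by (rule abs_sin_x_le_abs_x)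
      thus ?thesis by (simp only: abs_le_square_iff)
    qed
    also have "\<dots> \<le> \<theta> / 2"
      using \<theta> by (simp add: power2_eq_square mult_left_le)
    finally have "1 - cos \<theta> \<le> \<theta> / 2" .
    moreover have "0 < 1 - cos \<theta>" using cos1[of \<theta>] \<theta> pi_gt3 by auto
    ultimately have "2 \<le> \<theta> / (1 - cos \<theta>)" by (simp add: field_simps)
    hence "2 / pi * 2 \<le> h \<theta>" unfolding h_def by (intro mult_left_mono) auto
    moreover have "h pi = 1" by (simp add: h_def)
    moreover have "1 \<le> 2 / pi * 2" using pi_less_4 by (simp add: field_simps)
    ultimately show ?thesis by linarith
  qed
  have min: "h m \<le> h \<theta>" if "0 < \<theta>" "\<theta> \<le> pi" for \<theta>
  proof (cases "\<theta> \<le> 1")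
    case True
    have "h m \<le> h pi" using m pi_gt3 by auto
    thus ?thesis using small[of \<theta>] that True by linarith
  qed (use m that in auto)
  have m0: "0 < m" "m \<le> pi" using m(1) by auto
  have eq: "alpha_GW = h m"
    unfolding alpha_GW_def h_def[symmetric]
  proof (rule Least_equality)
    show "\<exists>\<theta>. 0 < \<theta> \<and> \<theta> \<le> pi \<and> h m = h \<theta>" using m0 by blast
    show "h m \<le> c" if "\<exists>\<theta>. 0 < \<theta> \<and> \<theta> \<le> pi \<and> c = h \<theta>" for c using that min by blast
  qed
  show "0 < alpha_GW"
    unfolding eq h_def using m0 cos1[OF m0] by simp
  show "alpha_GW \<le> 2 / pi * (\<theta> / (1 - cos \<theta>))" if "0 < \<theta>" "\<theta> \<le> pi" for \<theta>
    using min[OF that] unfolding eq by (simp add: h_def)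
qed

section \<open>Positive semidefinite matrices and Gram vectors\<close>

lemma sum_two_point:
  fixes f :: "'a \<Rightarrow> real"
  assumes "finite V" "i \<in> V" "j \<in> V" "i \<noteq> j" "\<And>k. k \<in> V \<Longrightarrow> k \<noteq> i \<Longrightarrow> k \<noteq> j \<Longrightarrow> f k = 0"
  shows "(\<Sum>k\<in>V. f k) = f i + f j"
proof -
  have "(\<Sum>k\<in>V. f k) = (\<Sum>k\<in>{i, j}. f k)"
    by (rule sum.mono_neutral_right) (use assms in auto)
  thus ?thesis using assms by simp
qed

text \<open>The quadratic form at the vector with entries \<open>a\<close> at \<open>i\<close>,
  \<open>b\<close> at \<open>j\<close> and 0 elsewhere.\<close>

lemma psd_on_quad2:
  assumes V: "finite V" and Y: "psd_on V Y" and ij: "i \<in> V" "j \<in> V" "i \<noteq> j"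
  shows "0 \<le> a\<^sup>2 * Y i i + 2 * a * b * Y i j + b\<^sup>2 * Y j j"
proof -
  define x where "x k = (if k = i then a else if k = j then b else 0)" for k
  have inner: "(\<Sum>l\<in>V. x k * Y k l * x l) = x k * Y k i * a + x k * Y k j * b" for k
    by (subst sum_two_point[of V i j]) (use V ij in \<open>auto simp: x_def\<close>)
  have "(\<Sum>k\<in>V. \<Sum>l\<in>V. x k * Y k l * x l) = a * Y i i * a + a * Y i j * b + (b * Y j i * a + b * Y j j * b)"
    unfolding inner by (subst sum_two_point[of V i j]) (use V ij in \<open>auto simp: x_def\<close>)
  moreover have "0 \<le> (\<Sum>k\<in>V. \<Sum>l\<in>V. x k * Y k l * x l)" and "Y j i = Y i j"
    using Y ij by (auto simp: psd_on_def)
  ultimately show ?thesis by (simp add: power2_eq_square algebra_simps)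
qed

lemma psd_on_diag_nonneg:
  assumes V: "finite V" and Y: "psd_on V Y" and i: "i \<in> V"
  shows "0 \<le> Y i i"
proof -
  define x where "x k = (if k = i then 1 else 0 :: real)" for k
  have "(\<Sum>k\<in>V. \<Sum>l\<in>V. x k * Y k l * x l) = Y i i"
    using V i by (simp add: x_def if_distrib[of "\<lambda>u. u * _"] if_distrib[of "\<lambda>u. _ * u"] sum.delta cong: if_cong)
  thus ?thesis using Y unfolding psd_on_def by metis
qed

text \<open>Test with the sum and the difference of two unit vectors. The bound later confines
  feasible matrices to a box and keeps \<open>Y i j / \<mu>\<close> in the domain of
  \<open>arccos\<close>.\<close>

lemma psd_on_abs_le:
  assumes V: "finite V" and Y: "psd_on V Y" and ij: "i \<in> V" "j \<in> V" and d: "Y i i = \<mu>" "Y j j = \<mu>"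
  shows "\<bar>Y i j\<bar> \<le> \<mu>"
proof (cases "i = j")
  case True
  thus ?thesis using psd_on_diag_nonneg[OF V Y ij(2)] ij d by simp
next
  case False
  show ?thesis
    using psd_on_quad2[OF V Y ij False, of 1 1] psd_on_quad2[OF V Y ij False, of 1 "-1"] d by simp
qed

lemma psd_on_zero_diag:
  assumes V: "finite V" and Y: "psd_on V Y" and ij: "i \<in> V" "j \<in> V" and d: "Y i i = 0"
  shows "Y i j = 0"
proof (cases "i = j")
  case False
  \<comment> \<open>If \<open>Y i j\<close> were nonzero, this choice would make
    \<open>2 * t * Y i j + Y j j\<close> equal to \<open>-1\<close>.\<close>
  define t where "t = - (Y j j + 1) / (2 * Y i j)"
  have "0 \<le> 2 * t * Y i j + Y j j"
    using psd_on_quad2[OF V Y ij False, of t 1] d by simp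
  thus ?thesis by (cases "Y i j = 0") (auto simp: t_def field_simps)
qed (use d in simp)

text \<open>Cholesky factorisation by induction on the index set: removing the index
  \<open>a\<close> leaves the Schur complement \<open>Z\<close>, which is again positive
  semidefinite, and its Gram vectors are extended by one coordinate.\<close>

lemma psd_on_gram:
  assumes "finite V" "psd_on V Y"
  shows "\<exists>(n::nat) v. \<forall>i\<in>V. \<forall>j\<in>V. Y i j = (\<Sum>k<n. v i k * v j k)"
  using assms
proof (induction V arbitrary: Y rule: finite_induct)
  case empty
  thus ?case by simp
next
  case (insert a V)
  have fin: "finite (insert a V)" using insert by simp
  have sym: "Y i j = Y j i" if "i \<in> insert a V" "j \<in> insert a V" for i j
    using insert.prems that by (auto simp: psd_on_def)
  have nonneg: "0 \<le> Y a a" by (rule psd_on_diag_nonneg[OF fin insert.prems]) simp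
  define Z where "Z i j = Y i j - Y i a * Y a j / Y a a" for i j
  have "psd_on V Z"
    unfolding psd_on_def
  proof (intro conjI ballI allI)
    fix i j assume "i \<in> V" "j \<in> V"
    thus "Z i j = Z j i" using sym[of i j] sym[of i a] sym[of a j] by (simp add: Z_def)
  next
    fix x :: "'a \<Rightarrow> real"
    define S where "S = (\<Sum>i\<in>V. x i * Y i a)"
    \<comment> \<open>The quadratic form of the Schur complement \<open>Z\<close> at \<open>x\<close> is that of \<open>Y\<close> minimised over the
      coordinate \<open>a\<close>; if \<open>Y a a = 0\<close>, then \<open>S = 0\<close> and division by zero is harmless.\<close>
    define x' where "x' i = (if i = a then - S / Y a a else x i)" for i
    have x': "x' i = x i" if "i \<in> V" for i using that insert.hyps by (auto simp: x'_def)
    have S': "(\<Sum>i\<in>V. Y a i * x i) = S"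
      unfolding S_def by (rule sum.cong) (auto simp: sym)
    have Saa: "S * S / Y a a * Y a a = S * S"
    proof (cases "Y a a = 0")
      case True
      have "Y i a = 0" if "i \<in> V" for i
        using psd_on_zero_diag[OF fin insert.prems _ _ True, of i] sym[of i a] that by simp
      thus ?thesis by (simp add: S_def)
    qed simp
    have "0 \<le> (\<Sum>i\<in>insert a V. \<Sum>j\<in>insert a V. x' i * Y i j * x' j)"
      using insert.prems unfolding psd_on_def by blast
    also have "\<dots> = x' a * Y a a * x' a + (\<Sum>j\<in>V. x' a * Y a j * x j)
        + (\<Sum>i\<in>V. x i * Y i a * x' a) + (\<Sum>i\<in>V. \<Sum>j\<in>V. x i * Y i j * x j)"
      using insert.hyps by (simp add: x' sum.distrib cong: sum.cong)
    also have "(\<Sum>j\<in>V. x' a * Y a j * x j) = x' a * S"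
      unfolding S'[symmetric] by (simp add: sum_distrib_left mult.assoc)
    also have "(\<Sum>i\<in>V. x i * Y i a * x' a) = S * x' a"
      unfolding S_def by (simp add: sum_distrib_right)
    also have "x' a * Y a a * x' a + x' a * S + S * x' a = - (S * S / Y a a)"
      using Saa by (cases "Y a a = 0") (auto simp: x'_def)
    also have "S * S / Y a a = (\<Sum>i\<in>V. \<Sum>j\<in>V. x i * (Y i a * Y a j / Y a a) * x j)"
    proof -
      have "S * S = (\<Sum>i\<in>V. x i * Y i a) * (\<Sum>j\<in>V. Y a j * x j)" unfolding S' by (simp add: S_def)
      also have "\<dots> = (\<Sum>i\<in>V. \<Sum>j\<in>V. x i * Y i a * (Y a j * x j))" by (rule sum_product)
      finally show ?thesis by (simp add: sum_divide_distrib mult.assoc)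
    qed
    also have "- \<dots> + (\<Sum>i\<in>V. \<Sum>j\<in>V. x i * Y i j * x j) = (\<Sum>i\<in>V. \<Sum>j\<in>V. x i * Z i j * x j)"
      by (simp add: Z_def algebra_simps sum_subtractf sum_distrib_left)
    finally show "0 \<le> (\<Sum>i\<in>V. \<Sum>j\<in>V. x i * Z i j * x j)" .
  qed
  from insert.IH[OF this] obtain n v where
    v: "\<forall>i\<in>V. \<forall>j\<in>V. Z i j = (\<Sum>k<(n::nat). v i k * v j k)" by blast
  \<comment> \<open>The new coordinate restores the rank-one term subtracted in \<open>Z\<close>. If
    \<open>Y a a = 0\<close>, the quotient is 0 by convention, which is right because the whole row
    and column of \<open>a\<close> vanish.\<close>
  define w where "w i k = (if k = n then Y i a / sqrt (Y a a) else if i = a then 0 else v i k)" for i and k :: nat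
  have w: "(\<Sum>k<Suc n. w i k * w j k) = (if i = a \<or> j = a then 0 else (\<Sum>k<n. v i k * v j k)) + Y i a * Y j a / Y a a" for i j
    using nonneg by (auto simp: w_def)
  have "Y i j = (\<Sum>k<Suc n. w i k * w j k)" if ij: "i \<in> insert a V" "j \<in> insert a V" for i j
  proof (cases "i = a \<or> j = a")
    case True
    show ?thesis
    proof (cases "Y a a = 0")
      case z: True
      hence "Y i j = 0"
        using True psd_on_zero_diag[OF fin insert.prems _ _ z, of i] psd_on_zero_diag[OF fin insert.prems _ _ z, of j] sym[of i j] ij by auto
      thus ?thesis using z True unfolding w by simp
    next
      case False
      thus ?thesis using True sym[of i j] ij unfolding w by auto
    qed
  next
    case False
    hence "Z i j = (\<Sum>k<n. v i k * v j k)" using v ij by auto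
    thus ?thesis using False sym[of a j] ij unfolding w by (simp add: Z_def)
  qed
  thus ?case by blast
qed

section \<open>Edge cuts, and feasible matrices from fractional cut covers\<close>

lemma edge_cut_pair:
  assumes "{i, j} \<in> E" "i \<noteq> j"
  shows "{i, j} \<in> edge_cut E S \<longleftrightarrow> (i \<in> S) \<noteq> (j \<in> S)"
  using assms by (cases "i \<in> S"; cases "j \<in> S") (auto simp: edge_cut_def Int_insert_left)

lemma graph_edge:
  assumes "finite_simple_graph V E" "{i, j} \<in> E"
  shows "i \<in> V" "j \<in> V" "i \<noteq> j"
  using assms by (auto simp: finite_simple_graph_def card_insert_if split: if_splits)

lemma graph_edge_cases:
  assumes "finite_simple_graph V E" "e \<in> E"
  obtains i j where "e = {i, j}" "i \<in> V" "j \<in> V" "i \<noteq> j"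
  using assms unfolding finite_simple_graph_def by (metis card_2_iff insert_subset)

text \<open>Each rank-one sign matrix has unit diagonal, so the diagonal of the combination is the
  total weight, and its quadratic form is a nonnegative combination of squares.\<close>

lemma cut_cover_imp_GW_feasible:
  assumes G: "finite_simple_graph V E" and y: "fractional_cut_cover V E z y"
  shows "\<exists>Y. GW_polar_feasible V E z (\<Sum>S\<in>Pow V. y S) Y"
proof -
  define \<sigma> where "\<sigma> S i = (if i \<in> S then 1 else - 1 :: real)" for S and i :: 'a
  define Y where "Y i j = (\<Sum>S\<in>Pow V. y S * (\<sigma> S i * \<sigma> S j))" for i j
  have fin: "finite V" "finite (Pow V)" using G by (auto simp: finite_simple_graph_def)
  have nn: "0 \<le> y S" if "S \<in> Pow V" for S using y that by (auto simp: fractional_cut_cover_def)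
  have "psd_on V Y"
    unfolding psd_on_def
  proof (intro conjI ballI allI)
    fix i j show "Y i j = Y j i" by (simp add: Y_def mult.commute)
  next
    fix x :: "'a \<Rightarrow> real"
    have "(\<Sum>i\<in>V. \<Sum>j\<in>V. x i * Y i j * x j) = (\<Sum>i\<in>V. \<Sum>j\<in>V. \<Sum>S\<in>Pow V. y S * ((x i * \<sigma> S i) * (x j * \<sigma> S j)))"
      by (simp add: Y_def sum_distrib_left sum_distrib_right mult_ac)
    also have "\<dots> = (\<Sum>i\<in>V. \<Sum>S\<in>Pow V. \<Sum>j\<in>V. y S * ((x i * \<sigma> S i) * (x j * \<sigma> S j)))"
      by (rule sum.cong[OF refl]) (rule sum.swap)
    also have "\<dots> = (\<Sum>S\<in>Pow V. \<Sum>i\<in>V. \<Sum>j\<in>V. y S * ((x i * \<sigma> S i) * (x j * \<sigma> S j)))"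
      by (rule sum.swap)
    also have "\<dots> = (\<Sum>S\<in>Pow V. y S * (\<Sum>i\<in>V. x i * \<sigma> S i)\<^sup>2)"
      by (simp only: power2_eq_square sum_product) (simp only: sum_distrib_left)
    also have "0 \<le> \<dots>" using nn by (intro sum_nonneg) auto
    finally show "0 \<le> (\<Sum>i\<in>V. \<Sum>j\<in>V. x i * Y i j * x j)" .
  qed
  moreover have "Y i i = (\<Sum>S\<in>Pow V. y S)" for i
    unfolding Y_def by (rule sum.cong) (auto simp: \<sigma>_def)
  moreover have "1/4 * laplacian_adjoint Y i j \<ge> z {i, j}" if e: "{i, j} \<in> E" for i j
  proof -
    have "1/4 * laplacian_adjoint Y i j = (\<Sum>S\<in>Pow V. 1/4 * (y S * (\<sigma> S i * \<sigma> S i) + y S * (\<sigma> S j * \<sigma> S j)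
        - y S * (\<sigma> S i * \<sigma> S j) - y S * (\<sigma> S j * \<sigma> S i)))"
      by (simp only: laplacian_adjoint_def Y_def sum_distrib_left sum.distrib[symmetric] sum_subtractf[symmetric])
    \<comment> \<open>The coefficient of \<open>y S\<close> is a quarter of the square of
      \<open>\<sigma> S i - \<sigma> S j\<close>: 1 if \<open>S\<close> separates \<open>i\<close>
      and \<open>j\<close>, otherwise 0.\<close>
    also have "\<dots> = (\<Sum>S\<in>Pow V. y S * indicator (edge_cut E S) {i, j})"
      using edge_cut_pair[OF e graph_edge(3)[OF G e]]
      by (intro sum.cong) (auto simp: \<sigma>_def indicator_def)
    also have "\<dots> \<ge> z {i, j}" using y e by (auto simp: fractional_cut_cover_def)
    finally show ?thesis .
  qed
  moreover have "0 \<le> (\<Sum>S\<in>Pow V. y S)" using nn by (rule sum_nonneg)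
  ultimately show ?thesis unfolding GW_polar_feasible_def by blast
qed

text \<open>Give every subset the weight \<open>C\<close>, the sum of all demands; an edge is
  already covered by the singleton of one of its ends. The cover supplies the initial upper bound
  for both minimisation problems.\<close>

lemma ex_fractional_cut_cover:
  assumes G: "finite_simple_graph V E" and z: "\<forall>e\<in>E. 0 \<le> z e"
  shows "\<exists>y. fractional_cut_cover V E z y"
proof -
  define C where "C = (\<Sum>e\<in>E. z e)"
  have fin: "finite V" "finite E"
    using G finite_subset[of E "Pow V"] by (auto simp: finite_simple_graph_def)
  have zC: "z e \<le> C" if "e \<in> E" for e
    unfolding C_def using member_le_sum[of e E z] that z fin by auto
  have C: "0 \<le> C" unfolding C_def using z by (simp add: sum_nonneg)
  have "z e \<le> (\<Sum>S\<in>Pow V. C * indicator (edge_cut E S) e)" if e: "e \<in> E" for e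
  proof -
    obtain i j where ij: "e = {i, j}" "i \<in> V" "j \<in> V" "i \<noteq> j" using graph_edge_cases[OF G e] by blast
    hence "e \<in> edge_cut E {i}" using edge_cut_pair[of i j E "{i}"] e by auto
    hence "C \<le> C * indicator (edge_cut E {i}) e" by simp
    also have "\<dots> \<le> (\<Sum>S\<in>Pow V. C * indicator (edge_cut E S) e)"
      by (rule member_le_sum) (use ij fin C in auto)
    finally show ?thesis using zC[OF e] by linarith
  qed
  thus ?thesis using C unfolding fractional_cut_cover_def by (intro exI[of _ "\<lambda>_. C"]) auto
qed

section \<open>Attainment of both minima by compactness\<close>

text \<open>Tychonoff's theorem: the topology on a function type is the product topology, and the
  box is a product of compact intervals.\<close>

lemma compact_box_fun:
  fixes a b :: "'b \<Rightarrow> real"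
  shows "compact {y. \<forall>i. a i \<le> y i \<and> y i \<le> b i}"
proof -
  have "compactin (product_topology (\<lambda>_. euclidean) UNIV) (PiE UNIV (\<lambda>i. {a i..b i}))"
    by (simp add: compactin_PiE)
  moreover have "PiE UNIV (\<lambda>i. {a i..b i}) = {y. \<forall>i. a i \<le> y i \<and> y i \<le> b i}"
    by (auto simp: PiE_def Pi_def)
  ultimately show ?thesis by (simp add: euclidean_product_topology)
qed

text \<open>
  Cutting the feasible set down to a box (entries off the relevant index set are put to \<open>0\<close>) makes
  it compact in the product topology.
\<close>

lemma fcc_attained:
  assumes G: "finite_simple_graph V E" and z: "\<forall>e\<in>E. 0 \<le> z e"
  shows "\<exists>y. fractional_cut_cover V E z y \<and> fcc V E z = (\<Sum>S\<in>Pow V. y S)"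
    and "\<And>y. fractional_cut_cover V E z y \<Longrightarrow> fcc V E z \<le> (\<Sum>S\<in>Pow V. y S)"
proof -
  have fin: "finite (Pow V)" using G by (auto simp: finite_simple_graph_def)
  obtain y0 where y0: "fractional_cut_cover V E z y0" using ex_fractional_cut_cover[OF assms] by blast
  define tot where "tot y = (\<Sum>S\<in>Pow V. y S)" for y :: "'a set \<Rightarrow> real"
  \<comment> \<open>A cover no dearer than \<open>y0\<close> has no single weight above the total of
    \<open>y0\<close>, so after truncation off \<open>Pow V\<close> it lies in this box. Dearer
    covers are compared through \<open>y0\<close>.\<close>
  define b where "b S = (if S \<in> Pow V then tot y0 else 0)" for S
  define K where "K = {y. \<forall>S. 0 \<le> y S \<and> y S \<le> b S} \<inter> {y. \<forall>e\<in>E. z e \<le> (\<Sum>S\<in>Pow V. y S * indicator (edge_cut E S) e)}"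
  have "compact K"
    unfolding K_def
  proof (rule compact_Int_closed[OF compact_box_fun])
    show "closed {y. \<forall>e\<in>E. z e \<le> (\<Sum>S\<in>Pow V. y S * indicator (edge_cut E S) e)}"
      unfolding Ball_def
      by (intro closed_Collect_all closed_Collect_imp closed_Collect_le continuous_intros) auto
  qed
  have cut: "fractional_cut_cover V E z (\<lambda>S. if S \<in> Pow V then y S else 0)
      \<and> tot (\<lambda>S. if S \<in> Pow V then y S else 0) = tot y" if "fractional_cut_cover V E z y" for y
  proof -
    have "(\<Sum>S\<in>Pow V. (if S \<in> Pow V then y S else 0) * indicator (edge_cut E S) e)
        = (\<Sum>S\<in>Pow V. y S * indicator (edge_cut E S) e)" for e
      by (rule sum.cong) auto
    moreover have "(\<Sum>S\<in>Pow V. (if S \<in> Pow V then y S else 0)) = (\<Sum>S\<in>Pow V. y S)"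
      by (rule sum.cong) auto
    ultimately show ?thesis using that by (simp only: fractional_cut_cover_def tot_def) auto
  qed
  have inK: "(\<lambda>S. if S \<in> Pow V then y S else 0) \<in> K"
    if y: "fractional_cut_cover V E z y" and le: "tot y \<le> tot y0" for y
  proof -
    have "y S \<le> tot y" if "S \<in> Pow V" for S
      unfolding tot_def using member_le_sum[of S "Pow V" y] that fin y by (auto simp: fractional_cut_cover_def)
    moreover have "0 \<le> y S" if "S \<in> Pow V" for S
      using y that by (simp add: fractional_cut_cover_def)
    ultimately have "0 \<le> (if S \<in> Pow V then y S else 0) \<and> (if S \<in> Pow V then y S else 0) \<le> b S" for S
      using le by (simp add: b_def order_trans[of "y S" "tot y"])
    thus ?thesis using cut[OF y] unfolding K_def fractional_cut_cover_def by blast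
  qed
  have "continuous_on K tot" unfolding tot_def
    by (intro continuous_on_sum continuous_on_subset[OF continuous_on_product_coordinates]) auto
  moreover have "K \<noteq> {}" using inK[OF y0] by auto
  ultimately obtain y where y: "y \<in> K" "\<And>y'. y' \<in> K \<Longrightarrow> tot y \<le> tot y'"
    using continuous_attains_inf[OF \<open>compact K\<close>] by blast
  have yf: "fractional_cut_cover V E z y" using y(1) by (auto simp: K_def fractional_cut_cover_def)
  have min: "tot y \<le> tot y'" if y': "fractional_cut_cover V E z y'" for y'
  proof (cases "tot y' \<le> tot y0")
    case True
    thus ?thesis using y(2)[OF inK[OF y' True]] cut[OF y'] by simp
  next
    case False
    thus ?thesis using y(2)[OF inK[OF y0]] cut[OF y0] by simp
  qed
  have eq: "fcc V E z = tot y"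
    unfolding fcc_def tot_def[symmetric] by (rule Least_equality) (use yf min in auto)
  show "\<exists>y. fractional_cut_cover V E z y \<and> fcc V E z = (\<Sum>S\<in>Pow V. y S)"
    using yf eq by (auto simp: tot_def)
  show "fcc V E z \<le> (\<Sum>S\<in>Pow V. y S)" if "fractional_cut_cover V E z y" for y
    using min[OF that] eq by (simp add: tot_def)
qed

text \<open>The scalar and the matrix are packed into one function on an option type, with
  \<open>None\<close> holding \<mu>, so that a single compact box serves both. Entries of a feasible
  matrix are bounded by its diagonal value, hence by \<open>\<mu>0\<close> for the candidates that
  matter.\<close>

lemma GW_polar_attained:
  assumes G: "finite_simple_graph V E" and z: "\<forall>e\<in>E. 0 \<le> z e"
  shows "\<exists>Y. GW_polar_feasible V E z (GW_polar V E z) Y"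
    and "\<And>\<mu> Y. GW_polar_feasible V E z \<mu> Y \<Longrightarrow> GW_polar V E z \<le> \<mu>"
proof -
  have fin: "finite V" using G by (auto simp: finite_simple_graph_def)
  obtain \<mu>0 Y0 where Y0: "GW_polar_feasible V E z \<mu>0 Y0"
    using ex_fractional_cut_cover[OF assms] cut_cover_imp_GW_feasible[OF G] by blast
  define b where "b p = (case p of None \<Rightarrow> \<mu>0 | Some (i, j) \<Rightarrow> if i \<in> V \<and> j \<in> V then \<mu>0 else 0)" for p
  define a where "a p = (case p of None \<Rightarrow> 0 | Some q \<Rightarrow> - b p)" for p :: "('a \<times> 'a) option"
  define K where "K = {f. \<forall>p. a p \<le> f p \<and> f p \<le> b p}
      \<inter> {f. GW_polar_feasible V E z (f None) (\<lambda>i j. f (Some (i, j)))}"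
  have "compact K"
    unfolding K_def
  proof (rule compact_Int_closed[OF compact_box_fun])
    show "closed {f :: ('a \<times> 'a) option \<Rightarrow> real. GW_polar_feasible V E z (f None) (\<lambda>i j. f (Some (i, j)))}"
      unfolding GW_polar_feasible_def psd_on_def laplacian_adjoint_def Ball_def
    proof (intro closed_Collect_conj closed_Collect_all closed_Collect_imp open_Collect_const)
      show "closed {f :: ('a \<times> 'a) option \<Rightarrow> real. 0 \<le> f None}"
        by (intro closed_Collect_le) auto
      show "closed {f :: ('a \<times> 'a) option \<Rightarrow> real. f (Some (i, j)) = f (Some (j, i))}" for i j
        by (intro closed_Collect_eq) auto
      show "closed {f :: ('a \<times> 'a) option \<Rightarrow> real. f (Some (i, i)) = f None}" for i
        by (intro closed_Collect_eq) auto
      show "closed {f :: ('a \<times> 'a) option \<Rightarrow> real. 0 \<le> (\<Sum>i\<in>V. \<Sum>j\<in>V. x i * f (Some (i, j)) * x j)}" for x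
        by (intro closed_Collect_le continuous_on_sum continuous_on_mult continuous_on_const) auto
      show "closed {f :: ('a \<times> 'a) option \<Rightarrow> real. z {i, j} \<le>
          1/4 * (f (Some (i, i)) + f (Some (j, j)) - f (Some (i, j)) - f (Some (j, i)))}" for i j
        by (intro closed_Collect_le continuous_on_add continuous_on_diff continuous_on_mult continuous_on_const) auto
    qed
  qed
  define pack where "pack \<mu> Y p = (case p of None \<Rightarrow> \<mu> | Some (i, j) \<Rightarrow> if i \<in> V \<and> j \<in> V then Y i j else 0)"
    for \<mu> :: real and Y p
  have inK: "pack \<mu> Y \<in> K" if Y: "GW_polar_feasible V E z \<mu> Y" and le: "\<mu> \<le> \<mu>0" for \<mu> Y
  proof -
    have "\<bar>Y i j\<bar> \<le> \<mu>0" if "i \<in> V" "j \<in> V" for i j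
      using psd_on_abs_le[OF fin, of Y i j \<mu>] Y that le by (auto simp: GW_polar_feasible_def)
    moreover have "0 \<le> \<mu>" using Y by (simp add: GW_polar_feasible_def)
    ultimately have "a p \<le> pack \<mu> Y p \<and> pack \<mu> Y p \<le> b p" for p
      using le by (cases p) (force simp: a_def b_def pack_def abs_le_iff split: prod.splits)+
    moreover have "psd_on V (\<lambda>i j. pack \<mu> Y (Some (i, j)))"
      using Y by (simp add: GW_polar_feasible_def psd_on_def pack_def cong: sum.cong)
    ultimately show ?thesis
      using Y graph_edge(1,2)[OF G] unfolding K_def GW_polar_feasible_def laplacian_adjoint_def
      by (auto simp: pack_def)
  qed
  have "continuous_on K (\<lambda>f. f None)"
    by (rule continuous_on_subset[OF continuous_on_product_coordinates]) auto
  moreover have "K \<noteq> {}" using inK[OF Y0] by auto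
  ultimately obtain f where f: "f \<in> K" "\<And>f'. f' \<in> K \<Longrightarrow> f None \<le> f' None"
    using continuous_attains_inf[OF \<open>compact K\<close>, of "\<lambda>f. f None"] by blast
  have min: "f None \<le> \<mu>" if Y: "GW_polar_feasible V E z \<mu> Y" for \<mu> Y
  proof (cases "\<mu> \<le> \<mu>0")
    case True
    thus ?thesis using f(2)[OF inK[OF Y True]] by (simp add: pack_def)
  next
    case False
    thus ?thesis using f(2)[OF inK[OF Y0]] by (simp add: pack_def)
  qed
  have ff: "GW_polar_feasible V E z (f None) (\<lambda>i j. f (Some (i, j)))" using f(1) by (simp add: K_def)
  have eq: "GW_polar V E z = f None"
    unfolding GW_polar_def by (rule Least_equality) (use ff min in blast)+
  show "\<exists>Y. GW_polar_feasible V E z (GW_polar V E z) Y" using ff eq by auto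
  show "\<And>\<mu> Y. GW_polar_feasible V E z \<mu> Y \<Longrightarrow> GW_polar V E z \<le> \<mu>" using min eq by simp
qed

section \<open>Rounding Gram vectors by the signs of Gaussian linear forms\<close>

text \<open>In the triangular form of the joint law the two linear forms are \<open>\<alpha>\<close>
  times the inner products of a planar Gaussian point with the unit vectors at angles
  \<open>0\<close> and \<open>\<theta>\<close>. Separation is therefore the union of two disjoint
  wedges of equal measure.\<close>

lemma gauss_separation:
  fixes a b :: "nat \<Rightarrow> real"
  assumes \<mu>: "0 < \<mu>" and a: "(\<Sum>k<n. a k * a k) = \<mu>" and b: "(\<Sum>k<n. b k * b k) = \<mu>"
    and ab: "(\<Sum>k<n. a k * b k) = \<mu> * cos \<theta>" and \<theta>: "0 \<le> \<theta>" "\<theta> \<le> pi"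
  defines "G \<equiv> PiM {..<n} (\<lambda>_. std_gauss)"
  shows "\<theta> / pi \<le> measure G {g \<in> space G. (0 < (\<Sum>k<n. a k * g k)) \<noteq> (0 < (\<Sum>k<n. b k * g k))}"
proof -
  obtain \<alpha> \<beta> \<gamma> where nn: "0 \<le> \<alpha>" "0 \<le> \<gamma>" and sq: "\<alpha>\<^sup>2 = \<mu>" "\<alpha> * \<beta> = \<mu> * cos \<theta>" "\<beta>\<^sup>2 + \<gamma>\<^sup>2 = \<mu>"
    and law: "\<And>F. case_prod F \<in> borel_measurable (borel \<Otimes>\<^sub>M borel) \<Longrightarrow>
        (\<integral>\<^sup>+g. F (\<Sum>k<n. a k * g k) (\<Sum>k<n. b k * g k) \<partial>G)
        = (\<integral>\<^sup>+x. \<integral>\<^sup>+y. F (\<alpha> * x) (\<beta> * x + \<gamma> * y) \<partial>std_gauss \<partial>std_gauss)"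
    using gauss_pair_law[of a n b] unfolding a b ab G_def by blast
  have \<alpha>: "0 < \<alpha>" using nn(1) sq(1) \<mu> by (cases "\<alpha> = 0") auto
  have \<beta>: "\<beta> = \<alpha> * cos \<theta>"
  proof -
    have "\<alpha> * \<beta> = \<alpha> * (\<alpha> * cos \<theta>)" using sq(1,2) by (simp add: power2_eq_square)
    thus ?thesis using \<alpha> by simp
  qed
  \<comment> \<open>The squares agree, and both sides are nonnegative because
    \<open>\<theta>\<close> lies between 0 and \<open>pi\<close>.\<close>
  have \<gamma>: "\<gamma> = \<alpha> * sin \<theta>"
  proof (rule power2_eq_imp_eq)
    have "\<gamma>\<^sup>2 = \<alpha>\<^sup>2 * (1 - (cos \<theta>)\<^sup>2)" using sq(1,3) \<beta> by (simp add: power_mult_distrib algebra_simps)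
    thus "\<gamma>\<^sup>2 = (\<alpha> * sin \<theta>)\<^sup>2" by (simp add: power_mult_distrib sin_squared_eq)
    show "0 \<le> \<alpha> * sin \<theta>" using \<alpha> \<theta> by (simp add: sin_ge_zero)
  qed (rule nn(2))
  define sep where "sep g \<longleftrightarrow> (0 < (\<Sum>k<n. a k * g k)) \<noteq> (0 < (\<Sum>k<n. b k * g k))" for g
  define F :: "real \<Rightarrow> real \<Rightarrow> ennreal" where "F u v = (if (0 < u) \<noteq> (0 < v) then 1 else 0)" for u v
  have Fm: "case_prod F \<in> borel_measurable (borel \<Otimes>\<^sub>M borel)"
    unfolding F_def by measurable
  have wm: "wedge 0 \<theta> \<union> wedge \<theta> 0 \<in> sets gauss_plane" by (intro sets.Un wedge_sets)
  have "emeasure G {g \<in> space G. sep g} = (\<integral>\<^sup>+g. indicator {g \<in> space G. sep g} g \<partial>G)"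
    by (rule nn_integral_indicator[symmetric]) (unfold G_def sep_def, measurable)
  also have "\<dots> = (\<integral>\<^sup>+g. F (\<Sum>k<n. a k * g k) (\<Sum>k<n. b k * g k) \<partial>G)"
    by (rule nn_integral_cong) (simp add: F_def sep_def indicator_def)
  also have "\<dots> = (\<integral>\<^sup>+x. \<integral>\<^sup>+y. F (\<alpha> * x) (\<beta> * x + \<gamma> * y) \<partial>std_gauss \<partial>std_gauss)"
    by (rule law[OF Fm])
  also have "\<dots> = (\<integral>\<^sup>+x. \<integral>\<^sup>+y. indicator (wedge 0 \<theta> \<union> wedge \<theta> 0) (x, y) \<partial>std_gauss \<partial>std_gauss)"
  proof -
    have "F (\<alpha> * x) (\<beta> * x + \<gamma> * y) = indicator (wedge 0 \<theta> \<union> wedge \<theta> 0) (x, y)" for x y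
    proof -
      have "\<beta> * x + \<gamma> * y = \<alpha> * (x * cos \<theta> + y * sin \<theta>)" by (simp add: \<beta> \<gamma> algebra_simps)
      thus ?thesis using \<alpha> by (auto simp: F_def wedge_def zero_less_mult_iff)
    qed
    thus ?thesis by simp
  qed
  also have "\<dots> = emeasure gauss_plane (wedge 0 \<theta> \<union> wedge \<theta> 0)"
    by (rule std_gauss.emeasure_pair_measure[OF wm, symmetric])
  finally have "measure G {g \<in> space G. sep g} = measure gauss_plane (wedge 0 \<theta> \<union> wedge \<theta> 0)"
    by (simp add: measure_def)
  also have "\<dots> = measure gauss_plane (wedge 0 \<theta>) + measure gauss_plane (wedge \<theta> 0)"
    by (rule gauss_plane.finite_measure_Union[OF wedge_sets wedge_sets]) (auto simp: wedge_def)
  also have "\<dots> = 2 * measure gauss_plane (wedge 0 \<theta>)" by (simp add: measure_wedge_swap)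
  also have "\<theta> / pi \<le> \<dots>" using measure_wedge_ge[OF \<theta>] by (simp add: field_simps)
  finally show ?thesis unfolding sep_def .
qed

text \<open>The weight covering an edge is \<open>\<mu> / alpha_GW\<close> times the probability
  that its ends are separated, so each constraint concerns only one pair of Gram vectors.\<close>

lemma GW_feasible_imp_cut_cover:
  assumes G: "finite_simple_graph V E" and Y: "GW_polar_feasible V E z \<mu> Y"
  shows "\<exists>y. fractional_cut_cover V E z y \<and> (\<Sum>S\<in>Pow V. y S) = 1 / alpha_GW * \<mu>"
proof -
  have fin: "finite V" using G by (auto simp: finite_simple_graph_def)
  have \<mu>: "0 \<le> \<mu>" and psd: "psd_on V Y" and diag: "\<And>i. i \<in> V \<Longrightarrow> Y i i = \<mu>"
    and zle: "\<And>i j. {i, j} \<in> E \<Longrightarrow> z {i, j} \<le> 1/4 * laplacian_adjoint Y i j"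
    using Y by (auto simp: GW_polar_feasible_def)
  have zle': "z {i, j} \<le> (\<mu> - Y i j) / 2" if "{i, j} \<in> E" for i j
  proof -
    have "i \<in> V" "j \<in> V" using graph_edge[OF G that] by auto
    moreover from this have "Y j i = Y i j" using psd by (auto simp: psd_on_def)
    ultimately show ?thesis using zle[OF that] diag by (simp add: laplacian_adjoint_def)
  qed
  obtain n v where v: "\<forall>i\<in>V. \<forall>j\<in>V. Y i j = (\<Sum>k<(n::nat). v i k * v j k)"
    using psd_on_gram[OF fin psd] by blast
  define M where "M = PiM {..<n} (\<lambda>_::nat. std_gauss)"
  interpret M: prob_space M unfolding M_def by (rule std_gauss_prod.prob_space_axioms)
  define T where "T g = {i \<in> V. 0 < (\<Sum>k<n. v i k * g k)}" for g
  define y where "y S = \<mu> / alpha_GW * measure M {g \<in> space M. T g = S}" for S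
  have ev: "{g \<in> space M. T g = S} \<in> sets M" if "S \<in> Pow V" for S
  proof -
    have "{g \<in> space M. T g = S} = {g \<in> space M. \<forall>i\<in>V. 0 < (\<Sum>k<n. v i k * g k) \<longleftrightarrow> i \<in> S}"
      using that by (auto simp: T_def)
    also have "\<dots> \<in> sets M" unfolding M_def using fin by measurable
    finally show ?thesis .
  qed
  have part: "(\<Sum>S\<in>A. measure M {g \<in> space M. T g = S}) = measure M {g \<in> space M. T g \<in> A}" if "A \<subseteq> Pow V" for A
  proof -
    have "measure M (\<Union>S\<in>A. {g \<in> space M. T g = S}) = (\<Sum>S\<in>A. measure M {g \<in> space M. T g = S})"
      using that fin ev by (intro M.finite_measure_finite_Union)
        (auto simp: disjoint_family_on_def intro: finite_subset[of A "Pow V"])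
    moreover have "(\<Union>S\<in>A. {g \<in> space M. T g = S}) = {g \<in> space M. T g \<in> A}" by auto
    ultimately show ?thesis by simp
  qed
  have "(\<Sum>S\<in>Pow V. y S) = \<mu> / alpha_GW * measure M {g \<in> space M. T g \<in> Pow V}"
    by (simp only: y_def sum_distrib_left[symmetric] part[OF subset_refl])
  also have "{g \<in> space M. T g \<in> Pow V} = space M" by (auto simp: T_def)
  finally have tot: "(\<Sum>S\<in>Pow V. y S) = 1 / alpha_GW * \<mu>" by (simp add: M.prob_space)
  have "z e \<le> (\<Sum>S\<in>Pow V. y S * indicator (edge_cut E S) e)" if e: "e \<in> E" for e
  proof -
    obtain i j where ij: "e = {i, j}" "i \<in> V" "j \<in> V" "i \<noteq> j" using graph_edge_cases[OF G e] by blast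
    have ijE: "{i, j} \<in> E" using e ij by simp
    define A where "A = {S \<in> Pow V. e \<in> edge_cut E S}"
    have "(\<Sum>S\<in>Pow V. y S * indicator (edge_cut E S) e) = (\<Sum>S\<in>A. y S)"
      unfolding A_def using fin by (intro sum.mono_neutral_cong_right) (auto simp: indicator_def)
    also have "\<dots> = \<mu> / alpha_GW * measure M {g \<in> space M. T g \<in> A}"
      by (simp only: y_def sum_distrib_left[symmetric], subst part) (auto simp: A_def)
    also have "{g \<in> space M. T g \<in> A} =
        {g \<in> space M. (0 < (\<Sum>k<n. v i k * g k)) \<noteq> (0 < (\<Sum>k<n. v j k * g k))}"
      unfolding A_def using ij edge_cut_pair[OF ijE ij(4)] by (auto simp: T_def)
    finally have sum_eq: "(\<Sum>S\<in>Pow V. y S * indicator (edge_cut E S) e) = \<mu> / alpha_GW *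
        measure M {g \<in> space M. (0 < (\<Sum>k<n. v i k * g k)) \<noteq> (0 < (\<Sum>k<n. v j k * g k))}" .
    have abs: "\<bar>Y i j\<bar> \<le> \<mu>" by (rule psd_on_abs_le[OF fin psd ij(2,3) diag diag]) (use ij in auto)
    show ?thesis
    \<comment> \<open>When \<open>\<mu> = 0\<close> all Gram vectors are zero and no angle exists;
      but then \<open>Y i j = 0\<close>, so the demand of the edge is at most 0.\<close>
    proof (cases "\<mu> = 0")
      case True
      thus ?thesis using zle'[OF ijE] abs sum_eq ij(1) by simp
    next
      case False
      hence pos: "0 < \<mu>" using \<mu> by simp
      define \<theta> where "\<theta> = arccos (Y i j / \<mu>)"
      have rng: "- 1 \<le> Y i j / \<mu>" "Y i j / \<mu> \<le> 1" using abs pos by (auto simp: abs_le_iff field_simps)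
      have \<theta>: "0 \<le> \<theta>" "\<theta> \<le> pi" and cos: "\<mu> * cos \<theta> = Y i j"
        using rng pos by (auto simp: \<theta>_def arccos_lbound arccos_ubound)
      have "\<theta> / pi \<le> measure M {g \<in> space M. (0 < (\<Sum>k<n. v i k * g k)) \<noteq> (0 < (\<Sum>k<n. v j k * g k))}"
        unfolding M_def
        by (rule gauss_separation[OF pos _ _ _ \<theta>]) (use v ij diag cos in auto)
      \<comment> \<open>The angle 0 is outside the range over which \<open>alpha_GW\<close> is
        minimised; there both sides are 0.\<close>
      moreover have "alpha_GW * (1 - cos \<theta>) / 2 \<le> \<theta> / pi"
      proof (cases "\<theta> = 0")
        case False
        hence "0 < 1 - cos \<theta>" using cos_monotone_0_pi[of 0 \<theta>] \<theta> by simp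
        thus ?thesis using alpha_GW_le[of \<theta>] False \<theta> by (simp add: field_simps)
      qed simp
      ultimately have "alpha_GW * (1 - cos \<theta>) / 2 \<le>
          measure M {g \<in> space M. (0 < (\<Sum>k<n. v i k * g k)) \<noteq> (0 < (\<Sum>k<n. v j k * g k))}"
        by linarith
      hence "\<mu> / alpha_GW * (alpha_GW * (1 - cos \<theta>) / 2) \<le> (\<Sum>S\<in>Pow V. y S * indicator (edge_cut E S) e)"
        unfolding sum_eq using alpha_GW_pos pos by (intro mult_left_mono) auto
      \<comment> \<open>The scaling cancels \<open>alpha_GW\<close> and leaves exactly the Laplacian
        bound on the demand from \<open>zle'\<close>.\<close>
      moreover have "\<mu> / alpha_GW * (alpha_GW * (1 - cos \<theta>) / 2) = (\<mu> - Y i j) / 2"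
        using alpha_GW_pos cos by (simp add: algebra_simps)
      ultimately show ?thesis using zle'[OF ijE] ij(1) by simp
    qed
  qed
  moreover have "0 \<le> y S" for S
    using \<mu> alpha_GW_pos by (simp add: y_def)
  ultimately show ?thesis using tot unfolding fractional_cut_cover_def by blast
qed

theorem corollary2:
  fixes V :: "'a set" and E :: "'a set set" and z :: "'a set \<Rightarrow> real"
  assumes "finite_simple_graph V E"
    and "\<forall>e\<in>E. 0 \<le> z e"
  shows "GW_polar V E z \<le> fcc V E z \<and> fcc V E z \<le> 1 / alpha_GW * GW_polar V E z"
proof
  obtain y where y: "fractional_cut_cover V E z y" "fcc V E z = (\<Sum>S\<in>Pow V. y S)"
    using fcc_attained(1)[OF assms] by blast
  thus "GW_polar V E z \<le> fcc V E z"
    using cut_cover_imp_GW_feasible[OF assms(1) y(1)] GW_polar_attained(2)[OF assms] by auto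
  obtain Y where "GW_polar_feasible V E z (GW_polar V E z) Y"
    using GW_polar_attained(1)[OF assms] by blast
  then obtain y where "fractional_cut_cover V E z y" "(\<Sum>S\<in>Pow V. y S) = 1 / alpha_GW * GW_polar V E z"
    using GW_feasible_imp_cut_cover[OF assms(1)] by blast
  thus "fcc V E z \<le> 1 / alpha_GW * GW_polar V E z"
    using fcc_attained(2)[OF assms] by metis
qed

end
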